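(* In the parameterization by $\beta$ of the deformations of the cusp $c_2$ of the orbifold $A$ (see context), the "circle" $|\beta|=\infty$ corresponds to the values of $(p_2,q_2)$ lying on the square (the boundary curve) with vertices $(\pm1,\pm1)$. That is, with $(p_2,q_2)=(p_2(\beta),q_2(\beta))\in\mathbb{R}^2$ determined by $p_2u(\beta)+q_2v(\beta)=2\pi i$ as in the context, the set of limit points in $\mathbb{R}^2$ of $(p_2(\beta),q_2(\beta))$ as $|\beta|\to\infty$, $\beta\in\Omega$, is exactly the square $\{(p,q)\in\mathbb{R}^2:\max(|p|,|q|)=1\}$.
   Context: Origin of the parameters. Let $T^2=\mathbb{R}^2/\mathbb{Z}^2$. $A^*$ is the hyperbolic manifold obtained from $T^2\times(0,1)$ by removing the alternating two-component link $X\cup Y$, where $X,Y$ project to $\{y=x\}$ and $\{y=-x\}$, $X$ passes above $Y$ at $(0,0)$ and below it at $(1/2,1/2)$. Its cusps are $X$, $Y$, $W=T^2\times\{0\}$, $Z=T^2\times\{1\}$. $A$ is the two-cusped hyperbolic orbifold $A^*/\tau$, $\tau(x,y,t)=(x,-y,1-t)$, with cusps $c_1$ (image of $X$ and $Y$) and $c_2$ (image of $W$ and $Z$). Deformations of the hyperbolic structure of $A$ are parameterized by two complex numbers $\alpha,\beta$, the complete structure being $\alpha=\beta=\frac{1+i}2$; the holonomies of the meridian and longitude at $c_2$ depend only on $\beta$ and are $$m_W(\beta)=\frac{\beta(\beta-1)}{(\beta-i)(\beta-(1+i))},\qquad l_W(\beta)=\frac{\beta(\beta-i)}{(\beta-1)(\beta-(1+i))}.$$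 Dehn surgery coordinates. Let $\Omega\subset\mathbb{C}$ be the simply connected domain obtained by removing from $\mathbb{C}$ the four infinite rays emanating from the corners $0,1,1+i,i$ of the unit square and pointing radially away from its centre, i.e. the rays $\{\frac{1+i}2+s(k-\frac{1+i}2):s\ge1\}$ for $k\in\{0,1,1+i,i\}$. Let $u(\beta)=\log m_W(\beta)$ and $v(\beta)=\log l_W(\beta)$ be the continuous branches on $\Omega$ normalized by $u=v=0$ at $\beta=\frac{1+i}2$. The generalized Dehn surgery coefficient $(p_2,q_2)$ of $c_2$ at $\beta$ is the pair of real numbers with $p_2u(\beta)+q_2v(\beta)=2\pi i$ (defined where $u(\beta),v(\beta)$ are linearly independent over $\mathbb{R}$). The "circle" $|\beta|=\infty$ is understood as the limit of larger and larger circles in the Riemann sphere. *)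

theory Defs
  imports "HOL-Analysis.Analysis"
begin

definition centre :: complex where
  "centre = (1 + \<i>) / 2"

definition Omega :: "complex set" where
  "Omega = UNIV - (\<Union>k\<in>{0, 1, 1 + \<i>, \<i>}. {centre + of_real s * (k - centre) | s::real. s \<ge> 1})"

definition m_W :: "complex \<Rightarrow> complex" where
  "m_W \<beta> = \<beta> * (\<beta> - 1) / ((\<beta> - \<i>) * (\<beta> - (1 + \<i>)))"

definition l_W :: "complex \<Rightarrow> complex" where
  "l_W \<beta> = \<beta> * (\<beta> - \<i>) / ((\<beta> - 1) * (\<beta> - (1 + \<i>)))"

definition is_log_branch :: "(complex \<Rightarrow> complex) \<Rightarrow> (complex \<Rightarrow> complex) \<Rightarrow> bool" where
  "is_log_branch f g \<longleftrightarrow>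
     continuous_on Omega g \<and> (\<forall>\<beta>\<in>Omega. exp (g \<beta>) = f \<beta>) \<and> g centre = 0"

(* Such a branch is unique only on Omega; its values elsewhere are arbitrary and are never used
   below, since only points of surgery_domain enter the statement. *)
definition log_branch :: "(complex \<Rightarrow> complex) \<Rightarrow> complex \<Rightarrow> complex" where
  "log_branch f = (SOME g. is_log_branch f g)"

definition u_W :: "complex \<Rightarrow> complex" where
  "u_W = log_branch m_W"

definition v_W :: "complex \<Rightarrow> complex" where
  "v_W = log_branch l_W"

(* Linear independence of the pair (u_W \<beta>, v_W \<beta>) over the reals is spelled out: the set-based
   library notion applied to {u_W \<beta>, v_W \<beta>} would accept u_W \<beta> = v_W \<beta> \<noteq> 0. *)
definition surgery_domain :: "complex set" where
  "surgery_domain =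
     {\<beta> \<in> Omega. \<forall>a b :: real. of_real a * u_W \<beta> + of_real b * v_W \<beta> = 0 \<longrightarrow> a = 0 \<and> b = 0}"

definition surgery_coeff :: "complex \<Rightarrow> real \<times> real" where
  "surgery_coeff \<beta> =
     (THE (p, q). of_real p * u_W \<beta> + of_real q * v_W \<beta> = 2 * of_real pi * \<i>)"

definition limit_points_at_infinity ::
  "(complex \<Rightarrow> 'a::topological_space) \<Rightarrow> complex set \<Rightarrow> 'a set" where
  "limit_points_at_infinity f D =
     {L. \<exists>b :: nat \<Rightarrow> complex. (\<forall>n. b n \<in> D) \<and> filterlim b at_infinity sequentially
           \<and> (\<lambda>n. f (b n)) \<longlonglongrightarrow> L}"

end

theory Submission
  imports Defs
begin

text \<open>
  Put the centre of the square at the origin and scale the corners to \<open>1, \<i>, -1, -\<i>\<close> by the coordinate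
  \<open>z = (\<beta> - centre) / centre\<close>. Each factor of \<open>m_W\<close> and \<open>l_W\<close> vanishes at one corner, and
  the removed ray at that corner is the preimage of the cut of the principal logarithm. Both
  branches on \<open>Omega\<close> are therefore given by one explicit function \<open>cusp_log\<close>, a signed sum of four
  principal logarithms: \<open>u = cusp_log z\<close> and \<open>v = cusp_log (\<i> * z)\<close>. Since \<open>cusp_log\<close> is odd, the
  quarter turn about the centre replaces \<open>(u, v)\<close> by \<open>(v, -u)\<close>, hence \<open>(p, q)\<close> by \<open>(q, -p)\<close>, and
  only one of the four sectors into which the rays divide a neighbourhood of infinity has to be
  studied.

  Let \<open>w = \<beta> - centre\<close> go to infinity in the sector to the right of the square, that is, with
  \<open>\<bar>Im w\<bar> < Re w\<close>. Both \<open>m_W\<close> and \<open>l_W\<close> tend to 1, so \<open>u\<close> and \<open>v\<close> tend to integer multiples of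
  \<open>2 \<pi> \<i>\<close>; following the logarithms (\<open>cusp_log_at_infinity\<close>) shows that these limits are
  \<open>-2 \<pi> \<i>\<close> and \<open>0\<close>, and to first order
    \<open>u = -2 \<pi> \<i> + 2 \<i> / w\<close> and \<open>v = 2 / w\<close>.
  The imaginary part of \<open>p u + q v = 2 \<pi> \<i>\<close> then forces \<open>p\<close> to tend to \<open>-1\<close>, while its real part
  \<open>p Re u + q Re v = 0\<close> makes \<open>q\<close> close to \<open>Re u / Re v\<close>, which is the slope
  \<open>Im w / Re w\<close> up to an error tending to 0 (\<open>surgery_coeff_sector\<close>). The slope takes all values in
  \<open>(-1, 1)\<close>, so the right sector sweeps out the side \<open>p = -1\<close> of the square, its end points being
  reached by letting the slope approach \<open>\<plusminus>1\<close>, and the other sectors sweep out the other three sides.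

  That there are no further limit points follows without passing to subsequences: on each
  sector \<open>max \<bar>p\<bar> \<bar>q\<bar>\<close> tends to 1, because \<open>\<bar>q\<bar>\<close> is at most \<open>1 + o(1)\<close> there, and the four sectors
  together contain every point of \<open>Omega\<close> near infinity (\<open>sup_norm_surgery_coeff\<close>).
\<close>

section \<open>Coordinates adapted to the square\<close>

text \<open>The corners \<open>1 + \<i>, \<i>, 0, 1\<close> have coordinates \<open>1, \<i>, -1, -\<i>\<close>.\<close>
definition unit_coord :: "complex \<Rightarrow> complex" where
  "unit_coord \<beta> = (\<beta> - centre) / centre"

text \<open>
  A logarithm of \<open>(1 + z) (1 - \<i> z) / ((1 + \<i> z) (1 - z))\<close>. The four terms are kept apart because
  the cut of each is exactly one of the removed rays, whereas the principal logarithm of the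
  quotient would be discontinuous elsewhere.
\<close>
definition cusp_log :: "complex \<Rightarrow> complex" where
  "cusp_log z = Ln (1 + z) + Ln (1 - \<i> * z) - Ln (1 + \<i> * z) - Ln (1 - z)"

definition rot :: "complex \<Rightarrow> complex" where
  "rot \<beta> = centre + \<i> * (\<beta> - centre)"

text \<open>
  The part of the plane between the rays through the corners \<open>1\<close> and \<open>1 + \<i>\<close>, extended inwards
  to the centre; in the coordinate \<open>z\<close> it is the open fourth quadrant.
\<close>
definition right_sector :: "complex set" where
  "right_sector = {\<beta>. \<bar>Im (\<beta> - centre)\<bar> < Re (\<beta> - centre)}"

text \<open>
  The determinant of the real linear system for \<open>(p, q)\<close> obtained from the real and imaginary
  parts of \<open>p u + q v = 2 \<pi> \<i>\<close>.
\<close>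
definition log_det :: "complex \<Rightarrow> real" where
  "log_det \<beta> = Re (u_W \<beta>) * Im (v_W \<beta>) - Im (u_W \<beta>) * Re (v_W \<beta>)"

lemma centre_nz [simp]: "centre \<noteq> 0"
  by (simp add: centre_def complex_eq_iff)

lemma Re_centre [simp]: "Re centre = 1/2" and Im_centre [simp]: "Im centre = 1/2"
  by (simp_all add: centre_def)

lemma unit_coord_centre [simp]: "unit_coord centre = 0"
  by (simp add: unit_coord_def)

lemma minus_centre_eq: "\<beta> - centre = centre * unit_coord \<beta>"
  by (simp add: unit_coord_def)

lemma unit_coord_rot [simp]: "unit_coord (rot \<beta>) = \<i> * unit_coord \<beta>"
  by (simp add: unit_coord_def rot_def)

lemma cusp_log_minus: "cusp_log (- z) = - cusp_log z"
  by (simp add: cusp_log_def)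

text \<open>
  For a corner with coordinate \<open>\<kappa>\<close> the point of its ray with parameter \<open>s\<close> has \<open>1 - z / \<kappa> = 1 - s\<close>,
  so the ray is the cut of \<open>Ln (1 - z / \<kappa>)\<close>.
\<close>
lemma corner_ray_iff:
  assumes k: "k - centre = \<kappa> * centre" and "\<kappa> \<noteq> 0"
  shows "\<beta> \<in> {centre + of_real s * (k - centre) | s::real. s \<ge> 1}
     \<longleftrightarrow> 1 - unit_coord \<beta> / \<kappa> \<in> \<real>\<^sub>\<le>\<^sub>0"
proof
  assume "\<beta> \<in> {centre + of_real s * (k - centre) | s::real. s \<ge> 1}"
  then obtain s :: real where s: "s \<ge> 1" "\<beta> = centre + of_real s * (k - centre)" by auto
  have "1 - unit_coord \<beta> / \<kappa> = of_real (1 - s)"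
    using assms s by (simp add: unit_coord_def)
  then show "1 - unit_coord \<beta> / \<kappa> \<in> \<real>\<^sub>\<le>\<^sub>0"
    using s by (metis diff_le_0_iff_le nonpos_Reals_of_real_iff)
next
  assume "1 - unit_coord \<beta> / \<kappa> \<in> \<real>\<^sub>\<le>\<^sub>0"
  then obtain r :: real where r: "r \<le> 0" "1 - unit_coord \<beta> / \<kappa> = of_real r"
    by (auto elim!: nonpos_Reals_cases)
  have "unit_coord \<beta> = of_real (1 - r) * \<kappa>"
    using r \<open>\<kappa> \<noteq> 0\<close> by (simp add: field_simps)
  then have "of_real (1 - r) * (k - centre) = \<beta> - centre"
    unfolding k minus_centre_eq[of \<beta>] by simp
  then have "\<beta> = centre + of_real (1 - r) * (k - centre)" by simp
  moreover have "1 - r \<ge> 1" using r by simp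
  ultimately show "\<beta> \<in> {centre + of_real s * (k - centre) | s::real. s \<ge> 1}" by blast
qed

lemma Omega_iff:
  "\<beta> \<in> Omega \<longleftrightarrow> 1 + unit_coord \<beta> \<notin> \<real>\<^sub>\<le>\<^sub>0 \<and> 1 - unit_coord \<beta> \<notin> \<real>\<^sub>\<le>\<^sub>0
     \<and> 1 + \<i> * unit_coord \<beta> \<notin> \<real>\<^sub>\<le>\<^sub>0 \<and> 1 - \<i> * unit_coord \<beta> \<notin> \<real>\<^sub>\<le>\<^sub>0"
proof -
  have nz: "(-1::complex) \<noteq> 0" "- \<i> \<noteq> 0" "(1::complex) \<noteq> 0" "\<i> \<noteq> 0" by simp_all
  have c0: "0 - centre = (-1) * centre" and c1: "1 - centre = (-\<i>) * centre"
    and c2: "1 + \<i> - centre = 1 * centre" and c3: "\<i> - centre = \<i> * centre"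
    by (simp_all add: complex_eq_iff)
  have "\<beta> \<in> Omega \<longleftrightarrow> (\<forall>k\<in>{0, 1, 1 + \<i>, \<i>}. \<beta> \<notin> {centre + of_real s * (k - centre) | s::real. s \<ge> 1})"
    by (simp add: Omega_def)
  also have "\<dots> \<longleftrightarrow> 1 - unit_coord \<beta> / (-1) \<notin> \<real>\<^sub>\<le>\<^sub>0 \<and> 1 - unit_coord \<beta> / (-\<i>) \<notin> \<real>\<^sub>\<le>\<^sub>0
     \<and> 1 - unit_coord \<beta> / 1 \<notin> \<real>\<^sub>\<le>\<^sub>0 \<and> 1 - unit_coord \<beta> / \<i> \<notin> \<real>\<^sub>\<le>\<^sub>0"
    by (simp only: ball_simps corner_ray_iff[OF c0 nz(1)] corner_ray_iff[OF c1 nz(2)] corner_ray_iff[OF c2 nz(3)]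
        corner_ray_iff[OF c3 nz(4)] simp_thms)
  finally show ?thesis by (auto simp: mult.commute)
qed

lemma slit_plane_star:
  fixes z :: complex
  assumes "1 + z \<notin> \<real>\<^sub>\<le>\<^sub>0" "0 \<le> s" "s \<le> 1"
  shows "1 + of_real s * z \<notin> \<real>\<^sub>\<le>\<^sub>0"
proof
  assume "1 + of_real s * z \<in> \<real>\<^sub>\<le>\<^sub>0"
  then have 1: "1 + s * Re z \<le> 0" "s * Im z = 0"
    by (auto simp: complex_nonpos_Reals_iff)
  then have "s > 0" using assms by (cases "s = 0") auto
  then have im: "Im z = 0" using 1 by simp
  have "1 + Re z > 0"
    using assms(1) im by (auto simp: complex_nonpos_Reals_iff)
  then have "s * (1 + Re z) > 0" using \<open>s > 0\<close> by simp
  then show False using 1 assms by (simp add: algebra_simps)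
qed

lemma centre_in_Omega [simp]: "centre \<in> Omega"
  by (simp add: Omega_iff)

text \<open>Connectedness makes the normalized logarithm branches unique.\<close>
lemma connected_Omega: "connected Omega"
proof (rule starlike_imp_connected)
  have "closed_segment centre \<beta> \<subseteq> Omega" if "\<beta> \<in> Omega" for \<beta>
  proof
    fix x assume "x \<in> closed_segment centre \<beta>"
    then obtain s where s: "0 \<le> s" "s \<le> 1" "x = (1 - s) *\<^sub>R centre + s *\<^sub>R \<beta>"
      by (auto simp: closed_segment_def)
    then have x: "unit_coord x = of_real s * unit_coord \<beta>"
      by (simp add: unit_coord_def scaleR_conv_of_real field_simps)
    show "x \<in> Omega"
      using that slit_plane_star[of "unit_coord \<beta>" s] slit_plane_star[of "- unit_coord \<beta>" s]
        slit_plane_star[of "\<i> * unit_coord \<beta>" s] slit_plane_star[of "- \<i> * unit_coord \<beta>" s] s(1,2)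
      by (simp add: Omega_iff x mult.left_commute)
  qed
  then show "starlike Omega"
    unfolding starlike_def using centre_in_Omega by blast
qed

section \<open>The logarithm branches in closed form\<close>

text \<open>
  The difference of two branches takes values in \<open>2 \<pi> \<i> \<int>\<close>, so by continuity it is constant on the
  connected set \<open>Omega\<close>, and it vanishes at the centre.
\<close>
lemma is_log_branch_unique:
  assumes "is_log_branch f g" "is_log_branch f h" "\<beta> \<in> Omega"
  shows "g \<beta> = h \<beta>"
proof -
  have "(\<lambda>x. g x - h x) constant_on Omega"
  proof (rule continuous_discrete_range_constant[OF connected_Omega])
    show "continuous_on Omega (\<lambda>x. g x - h x)"
      using assms by (auto simp: is_log_branch_def intro!: continuous_intros)
    fix x assume x: "x \<in> Omega"
    have ex: "exp (g y - h y) = 1" if "y \<in> Omega" for y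
      using assms that by (simp add: is_log_branch_def exp_diff) (metis exp_not_eq_zero)
    show "\<exists>e>0. \<forall>y. y \<in> Omega \<and> g y - h y \<noteq> g x - h x \<longrightarrow> e \<le> norm (g y - h y - (g x - h x))"
    proof (intro exI[of _ "2*pi"] conjI allI impI)
      fix y assume y: "y \<in> Omega \<and> g y - h y \<noteq> g x - h x"
      from ex[OF x] obtain m where m: "Re (g x - h x) = 0" "Im (g x - h x) = of_int (2*m) * pi"
        unfolding exp_eq_1 by blast
      from y ex[of y] obtain n where n: "Re (g y - h y) = 0" "Im (g y - h y) = of_int (2*n) * pi"
        unfolding exp_eq_1 by blast
      have "n \<noteq> m"
        using m n y by (auto simp: complex_eq_iff)
      then have "1 \<le> \<bar>n - m\<bar>" by linarith
      then have "1 \<le> \<bar>real_of_int (n - m)\<bar>" by linarith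
      then have "2 * pi * 1 \<le> 2 * pi * \<bar>real_of_int (n - m)\<bar>"
        by (intro mult_left_mono) auto
      also have "\<dots> = \<bar>Im (g y - h y - (g x - h x))\<bar>"
      proof -
        have "Im (g y - h y - (g x - h x)) = 2 * pi * real_of_int (n - m)"
          unfolding minus_complex.sel(2)[of "g y - h y"] m n by (simp add: algebra_simps)
        then show ?thesis by (simp only: abs_mult) simp
      qed
      also have "\<dots> \<le> norm (g y - h y - (g x - h x))"
        by (rule abs_Im_le_cmod)
      finally show "2 * pi \<le> norm (g y - h y - (g x - h x))" by simp
    qed auto
  qed
  then obtain c where c: "\<And>x. x \<in> Omega \<Longrightarrow> g x - h x = c"
    by (auto simp: constant_on_def)
  show ?thesis
    using c[of centre] c[of \<beta>] assms by (simp add: is_log_branch_def)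
qed

lemma log_branch_eq:
  assumes "is_log_branch f g" "\<beta> \<in> Omega"
  shows "log_branch f \<beta> = g \<beta>"
  using assms is_log_branch_unique[OF someI[of "is_log_branch f"], of g g \<beta>]
  unfolding log_branch_def by blast

lemma exp_cusp_log:
  assumes "1 + z \<noteq> 0" "1 - z \<noteq> 0" "1 + \<i> * z \<noteq> 0" "1 - \<i> * z \<noteq> 0"
  shows "exp (cusp_log z) = (1 + z) * (1 - \<i> * z) / ((1 + \<i> * z) * (1 - z))"
  using assms by (simp add: cusp_log_def exp_add exp_diff)

lemma corner_factors:
  "\<beta> = centre * (1 + unit_coord \<beta>)" "\<beta> - 1 = \<i> * centre * (1 - \<i> * unit_coord \<beta>)"
  "\<beta> - \<i> = - \<i> * centre * (1 + \<i> * unit_coord \<beta>)" "\<beta> - (1 + \<i>) = - centre * (1 - unit_coord \<beta>)"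
proof -
  have *: "\<beta> = centre + centre * unit_coord \<beta>" using minus_centre_eq[of \<beta>] by (simp add: algebra_simps)
  then show "\<beta> = centre * (1 + unit_coord \<beta>)" by (simp add: algebra_simps)
  have c: "\<i> * centre = centre - 1" by (simp add: complex_eq_iff)
  have "\<i> * centre * (1 - \<i> * unit_coord \<beta>) = \<i> * centre + centre * unit_coord \<beta>"
    by (simp add: algebra_simps)
  then show "\<beta> - 1 = \<i> * centre * (1 - \<i> * unit_coord \<beta>)" using * c by simp
  have c': "-\<i> * centre = centre - \<i>" by (simp add: complex_eq_iff)
  have "- \<i> * centre * (1 + \<i> * unit_coord \<beta>) = - \<i> * centre + centre * unit_coord \<beta>"
    by (simp add: algebra_simps)
  then show "\<beta> - \<i> = - \<i> * centre * (1 + \<i> * unit_coord \<beta>)"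
    unfolding c' using * by (simp add: algebra_simps)
  have "- centre = centre - (1 + \<i>)" by (simp add: complex_eq_iff)
  then show "\<beta> - (1 + \<i>) = - centre * (1 - unit_coord \<beta>)" using * by (simp add: algebra_simps)
qed

lemma Omega_factors_nonzero:
  assumes "\<beta> \<in> Omega"
  shows "1 + unit_coord \<beta> \<noteq> 0" "1 - unit_coord \<beta> \<noteq> 0" "1 + \<i> * unit_coord \<beta> \<noteq> 0" "1 - \<i> * unit_coord \<beta> \<noteq> 0"
  using assms unfolding Omega_iff by force+

lemma continuous_on_unit_coord: "continuous_on S unit_coord"
  unfolding unit_coord_def by (intro continuous_intros) auto

lemma u_W_eq: "\<beta> \<in> Omega \<Longrightarrow> u_W \<beta> = cusp_log (unit_coord \<beta>)"
proof -
  have "is_log_branch m_W (\<lambda>\<beta>. cusp_log (unit_coord \<beta>))"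
    unfolding is_log_branch_def
  proof (intro conjI ballI)
    show "continuous_on Omega (\<lambda>\<beta>. cusp_log (unit_coord \<beta>))"
      unfolding cusp_log_def by (intro continuous_intros continuous_on_unit_coord) (auto simp: Omega_iff)
    fix \<beta> assume \<beta>: "\<beta> \<in> Omega"
    note nz = Omega_factors_nonzero[OF \<beta>]
    have "m_W \<beta> = (centre * (1 + unit_coord \<beta>)) * (\<i> * centre * (1 - \<i> * unit_coord \<beta>)) /
        ((- \<i> * centre * (1 + \<i> * unit_coord \<beta>)) * (- centre * (1 - unit_coord \<beta>)))"
      unfolding m_W_def by (simp only: corner_factors[symmetric])
    also have "\<dots> = exp (cusp_log (unit_coord \<beta>))"
      unfolding exp_cusp_log[OF nz] by simp
    finally show "exp (cusp_log (unit_coord \<beta>)) = m_W \<beta>" ..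
  qed (simp add: cusp_log_def)
  then show "\<beta> \<in> Omega \<Longrightarrow> u_W \<beta> = cusp_log (unit_coord \<beta>)"
    unfolding u_W_def by (rule log_branch_eq)
qed

lemma v_W_eq: "\<beta> \<in> Omega \<Longrightarrow> v_W \<beta> = cusp_log (\<i> * unit_coord \<beta>)"
proof -
  have "is_log_branch l_W (\<lambda>\<beta>. cusp_log (\<i> * unit_coord \<beta>))"
    unfolding is_log_branch_def
  proof (intro conjI ballI)
    show "continuous_on Omega (\<lambda>\<beta>. cusp_log (\<i> * unit_coord \<beta>))"
      unfolding cusp_log_def by (intro continuous_intros continuous_on_unit_coord) (auto simp: Omega_iff)
    fix \<beta> assume \<beta>: "\<beta> \<in> Omega"
    note nz = Omega_factors_nonzero[OF \<beta>]
    have "exp (cusp_log (\<i> * unit_coord \<beta>)) = (1 + \<i> * unit_coord \<beta>) * (1 + unit_coord \<beta>) / ((1 - unit_coord \<beta>) * (1 - \<i> * unit_coord \<beta>))"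
      using nz by (subst exp_cusp_log) auto
    also have "\<dots> = (centre * (1 + unit_coord \<beta>)) * (- \<i> * centre * (1 + \<i> * unit_coord \<beta>)) /
        ((\<i> * centre * (1 - \<i> * unit_coord \<beta>)) * (- centre * (1 - unit_coord \<beta>)))"
      by (simp add: mult.commute)
    also have "\<dots> = l_W \<beta>"
      unfolding l_W_def by (simp only: corner_factors[symmetric])
    finally show "exp (cusp_log (\<i> * unit_coord \<beta>)) = l_W \<beta>" .
  qed (simp add: cusp_log_def)
  then show "\<beta> \<in> Omega \<Longrightarrow> v_W \<beta> = cusp_log (\<i> * unit_coord \<beta>)"
    unfolding v_W_def by (rule log_branch_eq)
qed

section \<open>Symmetry and the linear system for the coefficients\<close>

lemma rot_in_Omega_iff [simp]: "rot \<beta> \<in> Omega \<longleftrightarrow> \<beta> \<in> Omega"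
  by (auto simp: Omega_iff)

lemma u_W_rot: "\<beta> \<in> Omega \<Longrightarrow> u_W (rot \<beta>) = v_W \<beta>"
  by (simp add: u_W_eq v_W_eq)

lemma v_W_rot: "\<beta> \<in> Omega \<Longrightarrow> v_W (rot \<beta>) = - u_W \<beta>"
  by (simp add: u_W_eq v_W_eq cusp_log_minus flip: mult.assoc)

lemma surgery_domain_iff: "\<beta> \<in> surgery_domain \<longleftrightarrow> \<beta> \<in> Omega \<and> log_det \<beta> \<noteq> 0"
proof -
  let ?u = "u_W \<beta>" and ?v = "v_W \<beta>"
  have "(\<forall>a b :: real. of_real a * ?u + of_real b * ?v = 0 \<longrightarrow> a = 0 \<and> b = 0) \<longleftrightarrow> log_det \<beta> \<noteq> 0"
  proof
    assume li: "\<forall>a b :: real. of_real a * ?u + of_real b * ?v = 0 \<longrightarrow> a = 0 \<and> b = 0"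
    show "log_det \<beta> \<noteq> 0"
    proof
      assume D: "log_det \<beta> = 0"
      have "Im ?v = 0 \<and> - Im ?u = 0"
        using li[rule_format, of "Im ?v" "- Im ?u"] D
        by (simp add: complex_eq_iff log_det_def algebra_simps)
      moreover have "Re ?v = 0 \<and> - Re ?u = 0"
        using li[rule_format, of "Re ?v" "- Re ?u"] D
        by (simp add: complex_eq_iff log_det_def algebra_simps)
      ultimately have "?u = 0" by (simp add: complex_eq_iff)
      then show False using li[rule_format, of 1 0] by simp
    qed
  next
    assume D: "log_det \<beta> \<noteq> 0"
    show "\<forall>a b :: real. of_real a * ?u + of_real b * ?v = 0 \<longrightarrow> a = 0 \<and> b = 0"
    proof (intro allI impI)
      fix a b :: real assume "of_real a * ?u + of_real b * ?v = 0"
      then have e: "a * Re ?u + b * Re ?v = 0" "a * Im ?u + b * Im ?v = 0"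
        by (simp_all add: complex_eq_iff)
      have "a * log_det \<beta> = Im ?v * (a * Re ?u + b * Re ?v) - Re ?v * (a * Im ?u + b * Im ?v)"
        "b * log_det \<beta> = Re ?u * (a * Im ?u + b * Im ?v) - Im ?u * (a * Re ?u + b * Re ?v)"
        by (simp_all add: log_det_def algebra_simps)
      from this[unfolded e] show "a = 0 \<and> b = 0" using D by simp
    qed
  qed
  then show ?thesis by (simp add: surgery_domain_def)
qed

text \<open>Cramer's rule for the real and imaginary parts of the defining equation.\<close>
lemma surgery_coeff_eq:
  assumes "log_det \<beta> \<noteq> 0"
  shows "surgery_coeff \<beta> = (- 2 * pi * Re (v_W \<beta>) / log_det \<beta>, 2 * pi * Re (u_W \<beta>) / log_det \<beta>)"
proof -
  let ?u = "u_W \<beta>" and ?v = "v_W \<beta>" and ?D = "log_det \<beta>"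
  have "of_real p * ?u + of_real q * ?v = 2 * of_real pi * \<i> \<longleftrightarrow>
      p = - 2 * pi * Re ?v / ?D \<and> q = 2 * pi * Re ?u / ?D" for p q :: real
  proof
    assume "of_real p * ?u + of_real q * ?v = 2 * of_real pi * \<i>"
    then have e: "p * Re ?u + q * Re ?v = 0" "p * Im ?u + q * Im ?v = 2 * pi"
      by (simp_all add: complex_eq_iff)
    have "p * ?D = Im ?v * (p * Re ?u + q * Re ?v) - Re ?v * (p * Im ?u + q * Im ?v)"
      "q * ?D = Re ?u * (p * Im ?u + q * Im ?v) - Im ?u * (p * Re ?u + q * Re ?v)"
      by (simp_all add: log_det_def algebra_simps)
    then show "p = - 2 * pi * Re ?v / ?D \<and> q = 2 * pi * Re ?u / ?D"
      unfolding e using assms by (simp add: field_simps)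
  next
    assume pq: "p = - 2 * pi * Re ?v / ?D \<and> q = 2 * pi * Re ?u / ?D"
    have "p * Im ?u + q * Im ?v = 2 * pi * ?D / ?D"
      using pq by (simp add: log_det_def diff_divide_distrib algebra_simps)
    moreover have "p * Re ?u + q * Re ?v = 0"
      using pq by simp
    ultimately show "of_real p * ?u + of_real q * ?v = 2 * of_real pi * \<i>"
      using assms by (simp add: complex_eq_iff)
  qed
  then show ?thesis
    unfolding surgery_coeff_def by (intro the_equality) auto
qed

lemma log_det_rot: "\<beta> \<in> Omega \<Longrightarrow> log_det (rot \<beta>) = log_det \<beta>"
  by (simp add: log_det_def u_W_rot v_W_rot)

lemma rot_in_surgery_domain_iff [simp]: "rot \<beta> \<in> surgery_domain \<longleftrightarrow> \<beta> \<in> surgery_domain"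
  by (auto simp: surgery_domain_iff log_det_rot)

lemma surgery_coeff_rot:
  assumes "\<beta> \<in> surgery_domain"
  shows "surgery_coeff (rot \<beta>) = (snd (surgery_coeff \<beta>), - fst (surgery_coeff \<beta>))"
  using assms by (simp add: surgery_domain_iff surgery_coeff_eq log_det_rot u_W_rot v_W_rot)


section \<open>Asymptotics in the right sector\<close>

text \<open>
  In \<open>1 + x = x (1 + 1 / x)\<close> the two factors lie on opposite sides of the real axis and the second
  one has positive real part, so their arguments add up to a value strictly between \<open>-\<pi>\<close> and \<open>\<pi>\<close>.
\<close>
lemma Ln_one_plus_reciprocal:
  assumes "Im x \<noteq> 0" "norm x > 1"
  shows "Ln (1 + x) = Ln x + Ln (1 + 1 / x)"
proof -
  have x0: "x \<noteq> 0" using assms by auto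
  have "norm (1 / x) < 1" using assms x0 by (simp add: norm_divide divide_less_eq)
  then have "Re (1 + 1 / x) > 0"
    using abs_Re_le_cmod[of "1 / x"] by simp
  then have re: "\<bar>Im (Ln (1 + 1 / x))\<bar> < pi / 2" by (rule Re_Ln_pos_lt_imp)
  have nz: "1 + 1 / x \<noteq> 0" using \<open>Re (1 + 1 / x) > 0\<close> by force
  have im: "Im (1 + 1 / x) = - Im x / (norm x)\<^sup>2"
    by (simp add: Im_divide cmod_power2)
  have n: "(norm x)\<^sup>2 > 0" using x0 by simp
  have "Im (Ln x + Ln (1 + 1 / x)) \<in> {-pi<..pi}"
  proof (cases "Im x > 0")
    case True
    then have "0 < Im (Ln x) \<and> Im (Ln x) < pi" by (rule Im_Ln_pos_lt_imp)
    moreover have "\<not> Im (1 + 1 / x) \<ge> 0"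
      unfolding im using True n by (simp add: field_simps)
    then have "\<not> (0 \<le> Im (Ln (1 + 1 / x)) \<and> Im (Ln (1 + 1 / x)) \<le> pi)"
      using Im_Ln_pos_le[OF nz] by blast
    ultimately show ?thesis using re by auto
  next
    case False
    then have "\<not> (0 \<le> Im (Ln x) \<and> Im (Ln x) \<le> pi)"
      using assms Im_Ln_pos_le[OF x0] by auto
    moreover have "Im (1 + 1 / x) > 0"
      unfolding im using False assms n by (simp add: field_simps)
    then have "0 < Im (Ln (1 + 1 / x)) \<and> Im (Ln (1 + 1 / x)) < pi"
      by (rule Im_Ln_pos_lt_imp)
    ultimately show ?thesis
      using re mpi_less_Im_Ln[OF x0] Im_Ln_le_pi[OF x0] by auto
  qed
  then have "Ln (x * (1 + 1 / x)) = Ln x + Ln (1 + 1 / x)"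
    using Ln_times[OF x0 nz] by auto
  moreover have "x * (1 + 1 / x) = 1 + x" using x0 by (simp add: field_simps)
  ultimately show ?thesis by simp
qed

text \<open>
  Factoring \<open>z, -z, \<i> z, -\<i> z\<close> out of the four logarithms leaves the function at \<open>\<i> / z\<close> or
  \<open>1 / z\<close>, up to a multiple of \<open>2 \<pi> \<i>\<close> that depends on the quadrant of \<open>z\<close>. In the fourth quadrant
  the arguments of \<open>-z, \<i> z, -\<i> z\<close> exceed that of \<open>z\<close> by \<open>\<pi>, \<pi>/2, -\<pi>/2\<close>; counted with
  the signs of the four terms, these shifts add up to \<open>-2 \<pi>\<close> in the first identity and cancel in the second.
\<close>
lemma cusp_log_at_infinity:
  assumes "Re z > 0" "Im z < 0" "norm z > 1"
  shows "cusp_log z = cusp_log (\<i> / z) - 2 * of_real pi * \<i>" and "cusp_log (\<i> * z) = cusp_log (1 / z)"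
proof -
  have z0: "z \<noteq> 0" using assms by auto
  have 1: "Ln (1 + z) = Ln z + Ln (1 + 1 / z)"
    using Ln_one_plus_reciprocal[of z] assms by simp
  have 2: "Ln (1 - z) = Ln z + \<i> * pi + Ln (1 - 1 / z)"
    using Ln_one_plus_reciprocal[of "-z"] Ln_minus[OF z0] assms by simp
  have 3: "Ln (1 + \<i> * z) = Ln z + \<i> * pi / 2 + Ln (1 - \<i> / z)"
    using Ln_one_plus_reciprocal[of "\<i> * z"] Ln_times_ii[OF z0] assms by (simp add: norm_mult divide_divide_eq_left[symmetric])
  have "Ln (- (\<i> * z)) = Ln z - \<i> * pi / 2"
    using Ln_minus[of "\<i> * z"] Ln_times_ii[OF z0] assms z0 by simp
  then have 4: "Ln (1 - \<i> * z) = Ln z - \<i> * pi / 2 + Ln (1 + \<i> / z)"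
    using Ln_one_plus_reciprocal[of "- (\<i> * z)"] assms by (simp add: norm_mult divide_divide_eq_left[symmetric])
  show "cusp_log z = cusp_log (\<i> / z) - 2 * of_real pi * \<i>"
    unfolding cusp_log_def 1 2 3 4 by simp
  have "cusp_log (\<i> * z) = Ln (1 + \<i> * z) + Ln (1 + z) - Ln (1 - z) - Ln (1 - \<i> * z)"
    by (simp add: cusp_log_def)
  then show "cusp_log (\<i> * z) = cusp_log (1 / z)"
    unfolding cusp_log_def 1 2 3 4 by simp
qed

text \<open>The limit is the derivative \<open>1 - \<i> - \<i> + 1\<close> at the origin, where the function vanishes.\<close>
lemma cusp_log_quotient_tendsto: "((\<lambda>z. cusp_log z / z) \<longlongrightarrow> 2 - 2 * \<i>) (at 0)"
proof -
  have "(cusp_log has_field_derivative 2 - 2 * \<i>) (at 0)"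
    unfolding cusp_log_def by (rule derivative_eq_intros refl | simp)+
  then show ?thesis
    by (simp add: has_field_derivative_iff cusp_log_def)
qed

lemma filterlim_unit_coord: "filterlim unit_coord at_infinity at_infinity"
proof -
  have "filterlim (\<lambda>\<beta>. inverse centre * (- centre + \<beta>)) at_infinity at_infinity"
    by (intro tendsto_mult_filterlim_at_infinity[OF tendsto_const]
        tendsto_add_filterlim_at_infinity[OF tendsto_const] filterlim_ident) simp
  then show ?thesis
    by (simp add: unit_coord_def[abs_def] field_simps)
qed

lemma right_sector_iff: "\<beta> \<in> right_sector \<longleftrightarrow> Re (unit_coord \<beta>) > 0 \<and> Im (unit_coord \<beta>) < 0"
proof -
  have "Re (\<beta> - centre) = (Re (unit_coord \<beta>) - Im (unit_coord \<beta>)) / 2" "Im (\<beta> - centre) = (Re (unit_coord \<beta>) + Im (unit_coord \<beta>)) / 2"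
    unfolding minus_centre_eq[of \<beta>] by (simp_all add: field_simps)
  then show ?thesis unfolding right_sector_def by (auto simp: abs_less_iff)
qed

lemma right_sector_subset_Omega: "right_sector \<subseteq> Omega"
  by (auto simp: right_sector_iff Omega_iff complex_nonpos_Reals_iff)

text \<open>
  Outside the unit disc in \<open>z\<close> the coordinate axes consist of points of the removed rays, so a point
  of \<open>Omega\<close> lies in an open quadrant.
\<close>
lemma Omega_in_sectors:
  assumes "\<beta> \<in> Omega" "norm (unit_coord \<beta>) > 1"
  shows "\<exists>k<4. (rot ^^ k) \<beta> \<in> right_sector"
proof -
  let ?z = "unit_coord \<beta>"
  have "Re ?z \<noteq> 0"
  proof
    assume "Re ?z = 0"
    then have "\<bar>Im ?z\<bar> > 1" using assms(2) by (simp add: norm_complex_def)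
    then show False using assms(1) \<open>Re ?z = 0\<close> by (auto simp: Omega_iff complex_nonpos_Reals_iff)
  qed
  moreover have "Im ?z \<noteq> 0"
  proof
    assume "Im ?z = 0"
    then have "\<bar>Re ?z\<bar> > 1" using assms(2) by (simp add: norm_complex_def)
    then show False using assms(1) \<open>Im ?z = 0\<close> by (auto simp: Omega_iff complex_nonpos_Reals_iff)
  qed
  ultimately consider "(rot ^^ 0) \<beta> \<in> right_sector" | "(rot ^^ 1) \<beta> \<in> right_sector"
    | "(rot ^^ 2) \<beta> \<in> right_sector" | "(rot ^^ 3) \<beta> \<in> right_sector"
    by (auto simp: right_sector_iff numeral_eq_Suc) linarith+
  then show ?thesis by cases (meson zero_less_numeral one_less_numeral_iff numeral_less_iff semiring_norm)+
qed


lemma filterlim_inverse_unit_coord: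
  "filterlim (\<lambda>\<beta>. inverse (unit_coord \<beta>)) (at 0) at_infinity"
  using filterlim_unit_coord by (simp add: filterlim_inverse_at_iff)

lemma filterlim_ii_times: "filterlim (\<lambda>x. \<i> * x) (at 0) (at 0)"
  by (auto simp: filterlim_at eventually_at_filter intro!: tendsto_eq_intros)

text \<open>
  First-order behaviour of \<open>v\<close> and of \<open>u + 2 \<pi> \<i>\<close>: multiplied by \<open>w = centre * z\<close> they tend to
  \<open>(2 - 2 \<i>) centre = 2\<close> and \<open>(2 - 2 \<i>) \<i> centre = 2 \<i>\<close>.
\<close>
lemma cusp_log_inverse_tendsto:
  "((\<lambda>\<beta>. cusp_log (inverse (unit_coord \<beta>)) * (\<beta> - centre)) \<longlongrightarrow> 2) at_infinity"
  "((\<lambda>\<beta>. cusp_log (\<i> * inverse (unit_coord \<beta>)) * (\<beta> - centre)) \<longlongrightarrow> 2 * \<i>) at_infinity"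
proof -
  note lim1 = filterlim_compose[OF cusp_log_quotient_tendsto filterlim_inverse_unit_coord]
  note lim2 = filterlim_compose[OF cusp_log_quotient_tendsto filterlim_compose[OF filterlim_ii_times filterlim_inverse_unit_coord]]
  have c: "(2 - 2 * \<i>) * centre = 2" "(2 - 2 * \<i>) * (\<i> * centre) = 2 * \<i>"
    by (simp_all add: complex_eq_iff)
  show "((\<lambda>\<beta>. cusp_log (inverse (unit_coord \<beta>)) * (\<beta> - centre)) \<longlongrightarrow> 2) at_infinity"
    using tendsto_mult_right[OF lim1, of centre] unfolding c
    by (simp add: minus_centre_eq divide_inverse mult_ac)
  show "((\<lambda>\<beta>. cusp_log (\<i> * inverse (unit_coord \<beta>)) * (\<beta> - centre)) \<longlongrightarrow> 2 * \<i>) at_infinity"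
    using tendsto_mult_right[OF lim2, of "\<i> * centre"] unfolding c
    by (simp add: minus_centre_eq divide_inverse mult_ac)
qed

lemma cusp_log_tendsto_0: "(cusp_log \<longlongrightarrow> 0) (at 0)"
proof -
  have "isCont cusp_log 0"
    unfolding cusp_log_def by (intro continuous_intros) auto
  then show ?thesis by (simp add: isCont_def cusp_log_def)
qed

definition slope :: "complex \<Rightarrow> real" where
  "slope \<beta> = Im (\<beta> - centre) / Re (\<beta> - centre)"

lemma abs_slope_less_1: "\<beta> \<in> right_sector \<Longrightarrow> \<bar>slope \<beta>\<bar> < 1"
  by (simp add: right_sector_def slope_def)

text \<open>
  Extracting the nonzero factor \<open>Re w / \<bar>w\<bar>\<^sup>2\<close>, which cancels in Cramer's rule, leaves an expression
  in the slope of \<open>w\<close>. This keeps the estimates uniform up to the boundary of the sector.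
\<close>
lemma Re_divide_slope:
  assumes "Re w \<noteq> 0"
  shows "Re (h / w) = Re w / (norm w)\<^sup>2 * (Re h + Im w / Re w * Im h)"
proof -
  have "Re h + Im w / Re w * Im h = (Re h * Re w + Im h * Im w) / Re w"
    using assms by (simp add: field_simps)
  then show ?thesis using assms by (simp add: Re_divide cmod_power2)
qed

abbreviation "sector_at_infinity \<equiv> inf at_infinity (principal right_sector)"

text \<open>
  With \<open>c = Re w / \<bar>w\<bar>\<^sup>2\<close>, Cramer's rule has \<open>Re u = c a\<close>, \<open>Re v = c b\<close> and determinant \<open>c D\<close>,
  where \<open>b\<close> tends to 2, \<open>a\<close> is twice the slope up to \<open>o(1)\<close>, and \<open>D\<close> tends to \<open>4 \<pi>\<close>. The slope has
  no limit but is bounded, so products of it with null functions still tend to 0.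
\<close>
lemma surgery_coeff_sector:
  shows "\<forall>\<^sub>F \<beta> in sector_at_infinity. \<beta> \<in> surgery_domain"
    and "((\<lambda>\<beta>. fst (surgery_coeff \<beta>)) \<longlongrightarrow> -1) sector_at_infinity"
    and "((\<lambda>\<beta>. snd (surgery_coeff \<beta>) - slope \<beta>) \<longlongrightarrow> 0) sector_at_infinity"
proof -
  let ?F = sector_at_infinity
  define h where "h \<beta> = cusp_log (inverse (unit_coord \<beta>)) * (\<beta> - centre)" for \<beta>
  define g where "g \<beta> = cusp_log (\<i> * inverse (unit_coord \<beta>)) * (\<beta> - centre)" for \<beta>
  define A where "A \<beta> = Im (cusp_log (\<i> * inverse (unit_coord \<beta>)))" for \<beta>
  define B where "B \<beta> = Im (cusp_log (inverse (unit_coord \<beta>)))" for \<beta>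
  define a where "a \<beta> = Re (g \<beta>) + slope \<beta> * Im (g \<beta>)" for \<beta>
  define b where "b \<beta> = Re (h \<beta>) + slope \<beta> * Im (h \<beta>)" for \<beta>
  define D where "D \<beta> = a \<beta> * B \<beta> - (A \<beta> - 2 * pi) * b \<beta>" for \<beta>
  have le: "?F \<le> at_infinity" by simp
  have sec: "\<forall>\<^sub>F \<beta> in ?F. \<beta> \<in> right_sector" by (simp add: eventually_inf_principal)
  have slope: "\<forall>\<^sub>F \<beta> in ?F. norm (slope \<beta>) \<le> 1"
    using sec by eventually_elim (use abs_slope_less_1 in \<open>force simp: less_imp_le\<close>)
  have h: "(h \<longlongrightarrow> 2) ?F" and g: "(g \<longlongrightarrow> 2 * \<i>) ?F"
    using cusp_log_inverse_tendsto tendsto_mono[OF le] unfolding h_def[abs_def] g_def[abs_def] by blast+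
  have B: "(B \<longlongrightarrow> 0) ?F"
    unfolding B_def[abs_def]
    using tendsto_mono[OF le tendsto_Im[OF filterlim_compose[OF cusp_log_tendsto_0 filterlim_inverse_unit_coord]]] by simp
  have A: "(A \<longlongrightarrow> 0) ?F"
    unfolding A_def[abs_def]
    using tendsto_mono[OF le tendsto_Im[OF filterlim_compose[OF cusp_log_tendsto_0
      filterlim_compose[OF filterlim_ii_times filterlim_inverse_unit_coord]]]] by simp
  have "((\<lambda>\<beta>. slope \<beta> * Im (h \<beta>)) \<longlongrightarrow> 0) ?F"
    using tendsto_Im[OF h] by (intro lim_null_mult_left_bounded[OF slope]) simp
  then have b: "(b \<longlongrightarrow> 2) ?F"
    unfolding b_def[abs_def] using tendsto_add[OF tendsto_Re[OF h]] by fastforce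
  have "((\<lambda>\<beta>. slope \<beta> * (Im (g \<beta>) - 2)) \<longlongrightarrow> 0) ?F"
    using tendsto_diff[OF tendsto_Im[OF g] tendsto_const[of 2]]
    by (intro lim_null_mult_left_bounded[OF slope]) simp
  then have "((\<lambda>\<beta>. Re (g \<beta>) + slope \<beta> * (Im (g \<beta>) - 2)) \<longlongrightarrow> 0) ?F"
    using tendsto_add[OF tendsto_Re[OF g]] by fastforce
  then have a: "((\<lambda>\<beta>. a \<beta> - 2 * slope \<beta>) \<longlongrightarrow> 0) ?F"
    by (simp add: a_def algebra_simps)
  have "\<forall>\<^sub>F \<beta> in ?F. norm (a \<beta> - 2 * slope \<beta>) < 1"
    using tendstoD[OF a, of 1] by simp
  then have "\<forall>\<^sub>F \<beta> in ?F. norm (a \<beta>) \<le> 3"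
    using slope by eventually_elim (simp add: abs_le_iff abs_less_iff)
  then have "((\<lambda>\<beta>. a \<beta> * B \<beta>) \<longlongrightarrow> 0) ?F"
    by (rule lim_null_mult_left_bounded[OF _ B])
  then have "(D \<longlongrightarrow> 0 - (0 - 2 * pi) * 2) ?F"
    unfolding D_def[abs_def] by (intro tendsto_intros A b)
  then have D: "(D \<longlongrightarrow> 4 * pi) ?F" by simp
  have D0: "\<forall>\<^sub>F \<beta> in ?F. D \<beta> \<noteq> 0"
    by (rule tendsto_imp_eventually_ne[OF D]) simp
  have "\<forall>\<^sub>F \<beta> in at_infinity. norm (unit_coord \<beta>) > 1"
    using filterlim_at_infinity_imp_norm_at_top[OF filterlim_unit_coord]
    by (simp add: filterlim_at_top_dense)
  then have big: "\<forall>\<^sub>F \<beta> in ?F. norm (unit_coord \<beta>) > 1"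
    using le by (rule filter_leD[rotated])
  have ev: "\<forall>\<^sub>F \<beta> in ?F. \<beta> \<in> surgery_domain \<and> D \<beta> \<noteq> 0 \<and>
      surgery_coeff \<beta> = (- 2 * pi * b \<beta> / D \<beta>, 2 * pi * a \<beta> / D \<beta>)"
    using sec big D0
  proof eventually_elim
    case (elim \<beta>)
    define w where "w = \<beta> - centre"
    define c where "c = Re w / (norm w)\<^sup>2"
    have w: "Re w > 0" using elim by (auto simp: right_sector_def w_def)
    then have "w \<noteq> 0" by auto
    have c: "c \<noteq> 0" using w \<open>w \<noteq> 0\<close> by (simp add: c_def)
    have \<Omega>: "\<beta> \<in> Omega" using elim right_sector_subset_Omega by auto
    have z: "Re (unit_coord \<beta>) > 0" "Im (unit_coord \<beta>) < 0" using elim by (auto simp: right_sector_iff)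
    have u: "u_W \<beta> = cusp_log (\<i> * inverse (unit_coord \<beta>)) - 2 * of_real pi * \<i>"
      and v: "v_W \<beta> = cusp_log (inverse (unit_coord \<beta>))"
      using cusp_log_at_infinity[OF z elim(2)] \<Omega> by (simp_all add: u_W_eq v_W_eq divide_inverse)
    have "cusp_log (\<i> * inverse (unit_coord \<beta>)) = g \<beta> / w" "cusp_log (inverse (unit_coord \<beta>)) = h \<beta> / w"
      using \<open>w \<noteq> 0\<close> by (simp_all add: g_def h_def w_def)
    then have re: "Re (u_W \<beta>) = c * a \<beta>" "Re (v_W \<beta>) = c * b \<beta>"
      unfolding u v using Re_divide_slope[of w] w
      by (simp_all add: a_def b_def c_def slope_def w_def)
    have im: "Im (u_W \<beta>) = A \<beta> - 2 * pi" "Im (v_W \<beta>) = B \<beta>"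
      by (simp_all add: u v A_def B_def)
    have det: "log_det \<beta> = c * D \<beta>"
      by (simp add: log_det_def re im D_def algebra_simps)
    show ?case
      using c elim(3) \<Omega> surgery_coeff_eq[of \<beta>]
      by (simp add: surgery_domain_iff det re)
  qed
  show "\<forall>\<^sub>F \<beta> in ?F. \<beta> \<in> surgery_domain"
    using ev by eventually_elim simp
  have "((\<lambda>\<beta>. - 2 * pi * b \<beta> / D \<beta>) \<longlongrightarrow> - 2 * pi * 2 / (4 * pi)) ?F"
    by (intro tendsto_intros b D) simp
  then have "((\<lambda>\<beta>. - 2 * pi * b \<beta> / D \<beta>) \<longlongrightarrow> - 1) ?F" by simp
  then show "((\<lambda>\<beta>. fst (surgery_coeff \<beta>)) \<longlongrightarrow> -1) ?F"
    by (rule Lim_transform_eventually) (use ev in eventually_elim, simp)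
  have "((\<lambda>\<beta>. D \<beta> - 4 * pi) \<longlongrightarrow> 0) ?F"
    using tendsto_diff[OF D tendsto_const[of "4 * pi"]] by simp
  then have sD: "((\<lambda>\<beta>. slope \<beta> * (D \<beta> - 4 * pi)) \<longlongrightarrow> 0) ?F"
    by (rule lim_null_mult_left_bounded[OF slope])
  \<comment> \<open>\<open>2 \<pi> a / D - slope\<close> over the common denominator \<open>D\<close>, the numerator split into two null terms\<close>
  have "((\<lambda>\<beta>. (2 * pi * (a \<beta> - 2 * slope \<beta>) - slope \<beta> * (D \<beta> - 4 * pi)) / D \<beta>)
      \<longlongrightarrow> (2 * pi * 0 - 0) / (4 * pi)) ?F"
    by (intro tendsto_divide tendsto_diff tendsto_mult tendsto_const a sD D) simp
  then have "((\<lambda>\<beta>. (2 * pi * (a \<beta> - 2 * slope \<beta>) - slope \<beta> * (D \<beta> - 4 * pi)) / D \<beta>) \<longlongrightarrow> 0) ?F"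
    by simp
  then show "((\<lambda>\<beta>. snd (surgery_coeff \<beta>) - slope \<beta>) \<longlongrightarrow> 0) ?F"
    by (rule Lim_transform_eventually) (use ev in eventually_elim, simp add: field_simps)
qed

section \<open>All limit points lie on the square\<close>

definition sup_norm :: "real \<times> real \<Rightarrow> real" where
  "sup_norm L = max \<bar>fst L\<bar> \<bar>snd L\<bar>"

lemma filterlim_rot: "filterlim rot at_infinity at_infinity"
  unfolding rot_def[abs_def] diff_conv_add_uminus
  by (intro tendsto_add_filterlim_at_infinity[OF tendsto_const]
      tendsto_mult_filterlim_at_infinity[OF tendsto_const]
      tendsto_add_filterlim_at_infinity'[OF _ tendsto_const] filterlim_ident) simp

lemma filterlim_rot_funpow: "filterlim (rot ^^ k) at_infinity at_infinity"
  by (induction k) (auto simp: filterlim_ident id_def comp_def intro: filterlim_compose[OF filterlim_rot])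

lemma rot_funpow_in_surgery_domain_iff [simp]:
  "(rot ^^ k) \<beta> \<in> surgery_domain \<longleftrightarrow> \<beta> \<in> surgery_domain"
  by (induction k) auto

text \<open>The effect of \<open>rot\<close> on the surgery coefficients.\<close>
definition quarter_turn :: "real \<times> real \<Rightarrow> real \<times> real" where
  "quarter_turn L = (snd L, - fst L)"

lemma surgery_coeff_rot_funpow:
  "\<beta> \<in> surgery_domain \<Longrightarrow> surgery_coeff ((rot ^^ k) \<beta>) = (quarter_turn ^^ k) (surgery_coeff \<beta>)"
  by (induction k) (simp_all add: surgery_coeff_rot quarter_turn_def)

lemma sup_norm_quarter_turn: "sup_norm ((quarter_turn ^^ k) L) = sup_norm L"
  by (induction k) (auto simp: sup_norm_def quarter_turn_def max.commute)

text \<open>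
  The coefficients themselves have no limit, since \<open>q\<close> follows the slope; but the slope stays within
  \<open>[-1, 1]\<close>, so the maximum is governed by \<open>p\<close>.
\<close>
lemma sup_norm_surgery_coeff_sector:
  "((\<lambda>\<beta>. sup_norm (surgery_coeff \<beta>)) \<longlongrightarrow> 1) sector_at_infinity"
proof (rule tendstoI)
  fix e :: real assume e: "e > 0"
  have sec: "\<forall>\<^sub>F \<beta> in sector_at_infinity. \<beta> \<in> right_sector" by (simp add: eventually_inf_principal)
  show "\<forall>\<^sub>F \<beta> in sector_at_infinity. dist (sup_norm (surgery_coeff \<beta>)) 1 < e"
    using tendstoD[OF surgery_coeff_sector(2) e] tendstoD[OF surgery_coeff_sector(3) e] sec
  proof eventually_elim
    case (elim \<beta>)
    then show ?case
      using abs_slope_less_1[of \<beta>] by (auto simp: sup_norm_def dist_real_def)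
  qed
qed

text \<open>
  A suitable power of \<open>rot\<close> carries any point of \<open>Omega\<close> near infinity into the right sector, and
  the maximum is invariant under quarter turns.
\<close>
lemma sup_norm_surgery_coeff:
  "((\<lambda>\<beta>. sup_norm (surgery_coeff \<beta>)) \<longlongrightarrow> 1) (inf at_infinity (principal Omega))"
proof (rule tendstoI)
  fix e :: real assume e: "e > 0"
  let ?P = "\<lambda>\<beta>. \<beta> \<in> surgery_domain \<and> dist (sup_norm (surgery_coeff \<beta>)) 1 < e"
  have "\<forall>\<^sub>F \<beta> in sector_at_infinity. ?P \<beta>"
    using eventually_conj[OF surgery_coeff_sector(1) tendstoD[OF sup_norm_surgery_coeff_sector e]] .
  then have P: "\<forall>\<^sub>F \<beta> in at_infinity. \<beta> \<in> right_sector \<longrightarrow> ?P \<beta>"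
    by (simp add: eventually_inf_principal)
  have inv: "?P ((rot ^^ k) \<beta>) \<longleftrightarrow> ?P \<beta>" for k \<beta>
    by (auto simp: surgery_coeff_rot_funpow sup_norm_quarter_turn)
  have "\<forall>\<^sub>F \<beta> in at_infinity. (rot ^^ k) \<beta> \<in> right_sector \<longrightarrow> ?P \<beta>" for k
    using eventually_compose_filterlim[OF P filterlim_rot_funpow[of k]] unfolding inv .
  then have "\<forall>\<^sub>F \<beta> in at_infinity. \<forall>k\<in>{..<4::nat}. (rot ^^ k) \<beta> \<in> right_sector \<longrightarrow> ?P \<beta>"
    by (intro eventually_ball_finite) auto
  moreover have "\<forall>\<^sub>F \<beta> in at_infinity. norm (unit_coord \<beta>) > 1"
    using filterlim_at_infinity_imp_norm_at_top[OF filterlim_unit_coord]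
    by (simp add: filterlim_at_top_dense)
  ultimately have "\<forall>\<^sub>F \<beta> in at_infinity. \<beta> \<in> Omega \<longrightarrow> ?P \<beta>"
    by eventually_elim (use Omega_in_sectors in blast)
  then show "\<forall>\<^sub>F \<beta> in inf at_infinity (principal Omega). dist (sup_norm (surgery_coeff \<beta>)) 1 < e"
    unfolding eventually_inf_principal by (rule eventually_mono) blast
qed

lemma limit_point_sup_norm:
  assumes "L \<in> limit_points_at_infinity surgery_coeff surgery_domain"
  shows "sup_norm L = 1"
proof -
  from assms obtain s where s: "\<And>n. s n \<in> surgery_domain" "filterlim s at_infinity sequentially"
    "(\<lambda>n. surgery_coeff (s n)) \<longlonglongrightarrow> L"
    by (auto simp: limit_points_at_infinity_def)
  have "filterlim s (inf at_infinity (principal Omega)) sequentially"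
    using s by (auto simp: filterlim_inf filterlim_principal surgery_domain_iff)
  then have "(\<lambda>n. sup_norm (surgery_coeff (s n))) \<longlonglongrightarrow> 1"
    by (rule filterlim_compose[OF sup_norm_surgery_coeff])
  moreover have "(\<lambda>n. sup_norm (surgery_coeff (s n))) \<longlonglongrightarrow> sup_norm L"
    unfolding sup_norm_def using s(3) by (intro tendsto_intros)
  ultimately show ?thesis by (rule LIMSEQ_unique[symmetric])
qed

section \<open>Every point of the square is a limit point\<close>

lemma quarter_turn_limit_point:
  assumes "L \<in> limit_points_at_infinity surgery_coeff surgery_domain"
  shows "quarter_turn L \<in> limit_points_at_infinity surgery_coeff surgery_domain"
proof -
  from assms obtain s where s: "\<And>n. s n \<in> surgery_domain" "filterlim s at_infinity sequentially"
    "(\<lambda>n. surgery_coeff (s n)) \<longlonglongrightarrow> L"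
    by (auto simp: limit_points_at_infinity_def)
  have "(\<lambda>n. surgery_coeff (rot (s n))) \<longlonglongrightarrow> quarter_turn L"
    using s(1,3) by (auto simp: surgery_coeff_rot quarter_turn_def intro!: tendsto_intros)
  moreover have "filterlim (\<lambda>n. rot (s n)) at_infinity sequentially"
    by (rule filterlim_compose[OF filterlim_rot s(2)])
  ultimately show ?thesis
    unfolding limit_points_at_infinity_def using s(1)
    by (intro CollectI exI[of _ "\<lambda>n. rot (s n)"]) auto
qed

text \<open>
  The witness has slope \<open>q n / (n + 1)\<close>, which tends to \<open>q\<close> and has absolute value less than 1 even
  for \<open>\<bar>q\<bar> = 1\<close>; the end points of the side are thus reached although the bounding rays are removed.
\<close>
lemma left_side_limit_points:
  assumes "\<bar>q\<bar> \<le> 1"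
  shows "(-1, q) \<in> limit_points_at_infinity surgery_coeff surgery_domain"
proof -
  define s where "s n = centre + Complex (real (Suc n)) (q * real n)" for n
  have "s n \<in> right_sector" for n
    using mult_right_mono[OF assms, of "real n"] by (simp add: s_def right_sector_def abs_mult)
  moreover have inf: "filterlim s at_infinity sequentially"
  proof -
    have "filterlim (\<lambda>n. Complex (real (Suc n)) (q * real n)) at_infinity sequentially"
    proof (rule filterlim_norm_at_top_imp_at_infinity, rule filterlim_at_top_mono)
      show "filterlim (\<lambda>n. real n) at_top sequentially" by (rule filterlim_real_sequentially)
      show "\<forall>\<^sub>F n in sequentially. real n \<le> norm (Complex (real (Suc n)) (q * real n))"
      proof (intro always_eventually allI)
        fix n show "real n \<le> norm (Complex (real (Suc n)) (q * real n))"
          using abs_Re_le_cmod[of "Complex (real (Suc n)) (q * real n)"] by simp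
      qed
    qed
    then show ?thesis
      unfolding s_def[abs_def] by (rule tendsto_add_filterlim_at_infinity[OF tendsto_const])
  qed
  ultimately have s: "filterlim s sector_at_infinity sequentially"
    by (auto simp: filterlim_inf filterlim_principal)
  have slope: "(\<lambda>n. slope (s n)) \<longlonglongrightarrow> q"
  proof -
    have "(\<lambda>n. q * (real n / real (Suc n))) \<longlonglongrightarrow> q * 1"
      by (intro tendsto_intros LIMSEQ_n_over_Suc_n)
    then show ?thesis by (simp add: slope_def s_def)
  qed
  have "(\<lambda>n. snd (surgery_coeff (s n)) - slope (s n) + slope (s n)) \<longlonglongrightarrow> 0 + q"
    by (intro tendsto_add slope filterlim_compose[OF surgery_coeff_sector(3) s])
  then have "(\<lambda>n. (fst (surgery_coeff (s n)), snd (surgery_coeff (s n)))) \<longlonglongrightarrow> (-1, q)"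
    by (intro tendsto_Pair filterlim_compose[OF surgery_coeff_sector(2) s]) simp
  then have lim: "(\<lambda>n. surgery_coeff (s n)) \<longlonglongrightarrow> (-1, q)" by simp
  from eventually_compose_filterlim[OF surgery_coeff_sector(1) s]
  obtain N where N: "\<And>n. n \<ge> N \<Longrightarrow> s n \<in> surgery_domain"
    by (auto simp: eventually_sequentially)
  have "filterlim (\<lambda>n. s (n + N)) at_infinity sequentially"
    by (rule filterlim_compose[OF inf filterlim_add_const_nat_at_top])
  moreover have "(\<lambda>n. surgery_coeff (s (n + N))) \<longlonglongrightarrow> (-1, q)"
    by (rule LIMSEQ_ignore_initial_segment[OF lim])
  ultimately show ?thesis
    unfolding limit_points_at_infinity_def using N
    by (intro CollectI exI[of _ "\<lambda>n. s (n + N)"]) auto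
qed

theorem theorem4:
  "limit_points_at_infinity surgery_coeff surgery_domain =
     {(p, q). max (abs p) (abs q) = (1::real)}"
proof (intro equalityI subsetI)
  fix L assume "L \<in> limit_points_at_infinity surgery_coeff surgery_domain"
  from limit_point_sup_norm[OF this] show "L \<in> {(p, q). max (abs p) (abs q) = (1::real)}"
    by (cases L) (simp add: sup_norm_def)
next
  fix L :: "real \<times> real" assume "L \<in> {(p, q). max (abs p) (abs q) = (1::real)}"
  then obtain p q where L: "L = (p, q)" and pq: "max \<bar>p\<bar> \<bar>q\<bar> = 1" by auto
  let ?S = "limit_points_at_infinity surgery_coeff surgery_domain"
  note turn = quarter_turn_limit_point
  from pq consider "p = -1" "\<bar>q\<bar> \<le> 1" | "q = 1" "\<bar>p\<bar> \<le> 1" | "p = 1" "\<bar>q\<bar> \<le> 1" | "q = -1" "\<bar>p\<bar> \<le> 1"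
    by (auto simp: max_def abs_if split: if_splits)
  then show "L \<in> ?S"
  proof cases
    case 1 then show ?thesis using left_side_limit_points[of q] L by simp
  next
    case 2 then show ?thesis
      using turn[OF left_side_limit_points[of p]] L by (simp add: quarter_turn_def)
  next
    case 3 then show ?thesis
      using turn[OF turn[OF left_side_limit_points[of "- q"]]] L by (simp add: quarter_turn_def)
  next
    case 4 then show ?thesis
      using turn[OF turn[OF turn[OF left_side_limit_points[of "- p"]]]] L by (simp add: quarter_turn_def)
  qed
qed

end
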